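(* Let $k\ge2$ and $(x_n)_{n\in\mathbb{N}}\subseteq[0,1]$ be a sequence, and assume that for some $s_1,\dots,s_{k-1}>0$ we have $\limsup_{N\to\infty}R_k(s_1,\dots,s_{k-1},N)=\infty$. Then $(x_n)$ does not have Poissonian $p$-th order correlations for any $p\ge k$.
   Context: $\|x\|$ is the distance of $x$ to the nearest integer; $(\!(x)\!)$ is the signed distance of $x$ from the origin modulo 1 ($=\{x\}$ if $\{x\}\le\frac12$, $=\{x\}-1$ otherwise, $\{x\}$ the fractional part). $R_k(s_1,\dots,s_{k-1},N)=\frac1N\#\{(i_1,\dots,i_k): i_1,\dots,i_k\le N\text{ pairwise distinct},\ \|x_{i_1}-x_{i_{r+1}}\|\le s_r/N\ (1\le r<k)\}$. For compactly supported $f:\mathbb{R}^{p-1}\to[0,\infty)$, $R_p(f,N)=\frac1N\sum_{i_1,\dots,i_p\le N\text{ distinct}}f(N(\!(x_{i_1}-x_{i_2})\!),\dots,N(\!(x_{i_1}-x_{i_p})\!))$. The sequence has Poissonian $p$-th order correlations if $\lim_N R_p(f,N)=\int_{\mathbb{R}^{p-1}}f$ for all $f\in C_c(\mathbb{R}^{p-1})$. *)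

theory Defs
  imports "HOL-Analysis.Analysis"
begin

definition nint_dist :: "real \<Rightarrow> real" where
  "nint_dist t = infdist t \<int>"

definition signed_dist :: "real \<Rightarrow> real" where
  "signed_dist t = (if frac t \<le> 1/2 then frac t else frac t - 1)"

text \<open>
  Sequences and tuples are indexed from 1: a tuple \<open>(i\<^sub>1, \<dots>, i\<^sub>k)\<close> is an extensional function on
  \<open>{1..k}\<close>, and the value of a sequence at 0 plays no role.
\<close>

definition distinct_tuples :: "nat \<Rightarrow> nat \<Rightarrow> (nat \<Rightarrow> nat) set" where
  "distinct_tuples k N = {i \<in> {1..k} \<rightarrow>\<^sub>E {1..N}. inj_on i {1..k}}"

definition corr_count :: "(nat \<Rightarrow> real) \<Rightarrow> nat \<Rightarrow> (nat \<Rightarrow> real) \<Rightarrow> nat \<Rightarrow> real" where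
  "corr_count x k s N =
     1 / real N * real (card {i \<in> distinct_tuples k N.
        \<forall>r\<in>{1..<k}. nint_dist (x (i 1) - x (i (r + 1))) \<le> s r / real N})"

text \<open>
  Since \<open>p\<close> is a variable, the Euclidean space of dimension \<open>p - 1\<close> is modelled by the real-valued
  extensional functions on \<open>{1..<p}\<close>, with the product topology and the product Lebesgue measure.
\<close>

definition Rspace :: "nat \<Rightarrow> (nat \<Rightarrow> real) topology" where
  "Rspace p = product_topology (\<lambda>_. euclideanreal) {1..<p}"

definition Rmeasure :: "nat \<Rightarrow> (nat \<Rightarrow> real) measure" where
  "Rmeasure p = Pi\<^sub>M {1..<p} (\<lambda>_. lborel)"

text \<open>
  Test functions are nonnegative; splitting into positive and negative parts shows that this gives
  the same notion of Poissonian correlations as all real-valued test functions.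
\<close>

definition Cc_nonneg :: "nat \<Rightarrow> ((nat \<Rightarrow> real) \<Rightarrow> real) set" where
  "Cc_nonneg p = {f. continuous_map (Rspace p) euclideanreal f
     \<and> (\<forall>y\<in>topspace (Rspace p). 0 \<le> f y)
     \<and> compactin (Rspace p) (Rspace p closure_of {y \<in> topspace (Rspace p). f y \<noteq> 0})}"

definition corr_sum :: "(nat \<Rightarrow> real) \<Rightarrow> nat \<Rightarrow> ((nat \<Rightarrow> real) \<Rightarrow> real) \<Rightarrow> nat \<Rightarrow> real" where
  "corr_sum x p f N =
     1 / real N * (\<Sum>i\<in>distinct_tuples p N.
        f (\<lambda>r\<in>{1..<p}. real N * signed_dist (x (i 1) - x (i (r + 1)))))"

definition poissonian_correlations :: "nat \<Rightarrow> (nat \<Rightarrow> real) \<Rightarrow> bool" where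
  "poissonian_correlations p x \<longleftrightarrow>
     (\<forall>f\<in>Cc_nonneg p. (\<lambda>N. corr_sum x p f N) \<longlonglongrightarrow> (LINT y|Rmeasure p. f y))"

end

theory Submission
  imports Defs
begin

text \<open>
  Put \<open>S = Max s\<^sub>r\<close>, and call \<open>j\<close> a neighbour of \<open>i\<close> if \<open>x\<^sub>j\<close> is within \<open>S / N\<close> of \<open>x\<^sub>i\<close> modulo 1.
  A tuple counted by \<open>R\<^sub>k\<close> extends to one of length \<open>k + 1\<close> unless its entries exhaust the
  neighbours of \<open>i\<^sub>1\<close>, and there are at most \<open>N k\<^sup>k\<close> tuples of the latter kind.
  With all \<open>s\<^sub>r = S\<close>, this gives \<open>R\<^sub>k \<le> R\<^sub>p + C\<close> with \<open>C\<close> independent of \<open>N\<close>, and a test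
  function that is at least 1 on \<open>[-S, S]\<^sup>p\<^sup>-\<^sup>1\<close> has unbounded correlation sums.
\<close>

text \<open>\<open>nint_dist\<close> is an infimum over the integers, so it suffices to compare with
  each integer separately. This carries the pairs counted by \<open>corr_count\<close> over to the
  quantity that \<open>corr_sum\<close> sees.\<close>

lemma abs_signed_dist_le_nint_dist: "\<bar>signed_dist t\<bar> \<le> nint_dist t"
proof -
  have "\<bar>signed_dist t\<bar> \<le> dist t z" if "z \<in> \<int>" for z
  proof -
    from that obtain m where z: "z = of_int m" by (auto elim: Ints_cases)
    have t: "t - z = frac t + of_int (\<lfloor>t\<rfloor> - m)" by (simp add: z frac_def)
    have f: "0 \<le> frac t" "frac t < 1" by (simp_all add: frac_lt_1)
    \<comment> \<open>The three cases give \<open>\<bar>t - z\<bar>\<close> at least 1, equal to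
      \<open>frac t\<close>, and at least \<open>1 - frac t\<close>; each of these dominates
      \<open>\<bar>signed_dist t\<bar>\<close>.\<close>
    consider "\<lfloor>t\<rfloor> - m \<ge> 1" | "\<lfloor>t\<rfloor> - m = 0" | "\<lfloor>t\<rfloor> - m \<le> -1" by linarith
    then show ?thesis
    proof cases
      case 1
      then have "of_int (\<lfloor>t\<rfloor> - m) \<ge> (1::real)" by linarith
      then show ?thesis using f t unfolding signed_dist_def dist_real_def by (auto split: if_splits)
    next
      case 2
      then show ?thesis using f t unfolding signed_dist_def dist_real_def by (auto split: if_splits)
    next
      case 3
      then have "of_int (\<lfloor>t\<rfloor> - m) \<le> (-1::real)" by linarith
      then show ?thesis using f t unfolding signed_dist_def dist_real_def by (auto split: if_splits)
    qed
  qed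
  moreover have "(\<int> :: real set) \<noteq> {}" by (metis Ints_0 empty_iff)
  ultimately show ?thesis
    unfolding nint_dist_def infdist_def by (auto intro!: cINF_greatest)
qed

text \<open>The relation is left abstract so that the extension argument is pure counting, with
  constants independent of the sequence and of the radius.\<close>

definition star_tuples :: "(nat \<Rightarrow> nat \<Rightarrow> bool) \<Rightarrow> nat \<Rightarrow> nat \<Rightarrow> (nat \<Rightarrow> nat) set" where
  "star_tuples E k N = {i \<in> distinct_tuples k N. \<forall>r\<in>{1..<k}. E (i 1) (i (r + 1))}"

lemma finite_distinct_tuples: "finite (distinct_tuples k N)"
  unfolding distinct_tuples_def by (auto intro!: finite_PiE)

lemma finite_star_tuples: "finite (star_tuples E k N)"
  unfolding star_tuples_def using finite_distinct_tuples by simp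

lemma card_star_tuples_Suc:
  assumes "k \<ge> 1"
  shows "card (star_tuples E k N) \<le> card (star_tuples E (Suc k) N) + N * k ^ k"
proof -
  \<comment> \<open>The centre is inserted because \<open>E\<close> need not be reflexive, while
    \<open>H (i 1)\<close> has to contain every entry of the tuple, including
    \<open>i 1\<close>.\<close>
  define H where "H a = insert a {j \<in> {1..N}. E a j}" for a
  have finH: "finite (H a)" for a by (simp add: H_def)
  define A where "A = {a \<in> {1..N}. card (H a) \<le> k}"
  \<comment> \<open>\<open>?R\<close> collects the tuples that extend by one entry,
    \<open>?B\<close> covers the others. Injectivity is dropped in \<open>?B\<close>, which makes
    its size a plain power.\<close>
  let ?B = "\<Union>a\<in>A. {1..k} \<rightarrow>\<^sub>E H a"
  let ?R = "(\<lambda>i. restrict i {1..k}) ` star_tuples E (Suc k) N"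
  have "i \<in> ?R \<union> ?B" if "i \<in> star_tuples E k N" for i
  proof -
    have i: "i \<in> {1..k} \<rightarrow>\<^sub>E {1..N}" "inj_on i {1..k}" "\<And>r. r \<in> {1..<k} \<Longrightarrow> E (i 1) (i (r + 1))"
      using that by (auto simp: star_tuples_def distinct_tuples_def)
    have i1: "i 1 \<in> {1..N}" using i(1) assms by (auto simp: PiE_iff)
    have sub: "i j \<in> H (i 1)" if "j \<in> {1..k}" for j
    proof (cases "j = 1")
      case False
      then have "E (i 1) (i (j - 1 + 1))" using that by (intro i(3)) auto
      then show ?thesis using that i(1) False by (auto simp: H_def PiE_iff)
    qed (simp add: H_def)
    show ?thesis
    proof (cases "H (i 1) \<subseteq> i ` {1..k}")
      case True
      then have "card (H (i 1)) \<le> k"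
        by (metis card_atLeastAtMost card_image diff_Suc_1 finite_atLeastAtMost finite_imageI i(2) card_mono)
      then have "i 1 \<in> A" using i1 by (simp add: A_def)
      moreover have "i \<in> {1..k} \<rightarrow>\<^sub>E H (i 1)" using sub i(1) by (auto simp: PiE_iff)
      ultimately show ?thesis by blast
    next
      case False
      then obtain b where b: "b \<in> H (i 1)" "b \<notin> i ` {1..k}" by blast
      \<comment> \<open>Since \<open>k \<ge> 1\<close>, the centre \<open>i 1\<close> is among the
        entries, so \<open>b\<close> differs from it and lies in \<open>H (i 1)\<close> by being a
        genuine neighbour.\<close>
      have b': "b \<in> {1..N}" "E (i 1) b" using b assms by (auto simp: H_def)
      let ?i = "i(Suc k := b)"
      have ins: "{1..Suc k} = insert (Suc k) {1..k}" by auto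
      have "inj_on ?i {1..Suc k}"
        unfolding ins inj_on_insert using inj_on_fun_updI[OF i(2) b(2)] b(2) by auto
      moreover have "?i \<in> {1..Suc k} \<rightarrow>\<^sub>E {1..N}"
        unfolding ins using b'(1) i(1) by (rule PiE_fun_upd)
      moreover have "E (?i 1) (?i (r + 1))" if "r \<in> {1..<Suc k}" for r
        using that i(3)[of r] b'(2) assms by (cases "r = k") auto
      ultimately have "?i \<in> star_tuples E (Suc k) N"
        by (auto simp: star_tuples_def distinct_tuples_def)
      moreover have "i = restrict ?i {1..k}"
        using i(1) by (auto simp: fun_eq_iff PiE_iff extensional_def)
      ultimately show ?thesis by blast
    qed
  qed
  then have "star_tuples E k N \<subseteq> ?R \<union> ?B" by blast
  moreover have "finite (?R \<union> ?B)"
    by (auto simp: A_def finH intro!: finite_star_tuples finite_PiE)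
  ultimately have "card (star_tuples E k N) \<le> card (?R \<union> ?B)" by (rule card_mono[rotated])
  also have "\<dots> \<le> card ?R + card ?B" by (rule card_Un_le)
  also have "card ?R \<le> card (star_tuples E (Suc k) N)"
    by (rule card_image_le[OF finite_star_tuples])
  also have "card ?B \<le> (\<Sum>a\<in>A. card ({1..k} \<rightarrow>\<^sub>E H a))"
    by (rule card_UN_le) (simp add: A_def)
  also have "\<dots> \<le> (\<Sum>a\<in>A. k ^ k)"
    by (intro sum_mono) (auto simp: A_def card_PiE intro: power_mono)
  also have "\<dots> = card A * k ^ k" by simp
  also have "card A \<le> N"
    using card_mono[of "{1..N}" A] by (simp add: A_def subset_iff)
  finally show ?thesis by simp
qed

text \<open>Iterating the one-step extension gives \<open>C\<close> as the sum of
  \<open>q ^ q\<close> over \<open>k \<le> q < p\<close>. It is chosen before \<open>E\<close> and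
  \<open>N\<close> because the neighbour relation used later changes with \<open>N\<close>.\<close>

lemma card_star_tuples_le:
  assumes "k \<ge> 1" "p \<ge> k"
  obtains C where "\<And>E N. card (star_tuples E k N) \<le> card (star_tuples E p N) + N * C"
proof -
  from assms(2) have "\<exists>C. \<forall>E N. card (star_tuples E k N) \<le> card (star_tuples E p N) + N * C"
  proof (induction p rule: dec_induct)
    case base
    show ?case by (intro exI[of _ 0]) simp
  next
    case (step p)
    then obtain C where C: "card (star_tuples E k N) \<le> card (star_tuples E p N) + N * C" for E N
      by blast
    have "card (star_tuples E k N) \<le> card (star_tuples E (Suc p) N) + N * (C + p ^ p)" for E N
      using C[of E N] card_star_tuples_Suc[of p E N] step(1) assms(1) by (simp add: algebra_simps)
    then show ?case by blast
  qed
  then show thesis using that by blast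
qed

text \<open>A product of tents, each of which equals 1 at distance \<open>S\<close> from 0 and
  vanishes from distance \<open>1 + S\<close> on.\<close>

definition box_bump :: "nat \<Rightarrow> real \<Rightarrow> (nat \<Rightarrow> real) \<Rightarrow> real" where
  "box_bump p S y = (\<Prod>r\<in>{1..<p}. max 0 (1 + S - \<bar>y r\<bar>))"

lemma box_bump_nonneg: "box_bump p S y \<ge> 0"
  unfolding box_bump_def by (intro prod_nonneg) auto

lemma box_bump_ge_1: "(\<And>r. r \<in> {1..<p} \<Longrightarrow> \<bar>y r\<bar> \<le> S) \<Longrightarrow> box_bump p S y \<ge> 1"
  unfolding box_bump_def by (intro prod_ge_1) force

lemma box_bump_in_Cc_nonneg: "box_bump p S \<in> Cc_nonneg p"
proof -
  let ?K = "PiE {1..<p} (\<lambda>_. {-(1 + S)..1 + S})"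
  have "continuous_map (Rspace p) euclideanreal (box_bump p S)"
    unfolding box_bump_def Rspace_def
    by (intro continuous_map_prod continuous_map_real_max continuous_map_diff
        continuous_map_real_abs continuous_map_product_projection) auto
  moreover have "compactin (Rspace p) (Rspace p closure_of {y \<in> topspace (Rspace p). box_bump p S y \<noteq> 0})"
  proof (rule closed_compactin)
    show "compactin (Rspace p) ?K"
      unfolding Rspace_def by (simp add: compactin_PiE)
    have "closedin (Rspace p) ?K"
      unfolding Rspace_def by (auto intro!: closedin_product_topology[THEN iffD2])
    \<comment> \<open>Outside the box some factor is zero; as the box is closed, it also contains
      the closure of the nonvanishing set.\<close>
    moreover have "{y \<in> topspace (Rspace p). box_bump p S y \<noteq> 0} \<subseteq> ?K"
      unfolding Rspace_def box_bump_def by (force simp: PiE_iff max_def split: if_splits)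
    ultimately show "Rspace p closure_of {y \<in> topspace (Rspace p). box_bump p S y \<noteq> 0} \<subseteq> ?K"
      by (rule closure_of_minimal[rotated])
  qed simp
  ultimately show ?thesis by (simp add: Cc_nonneg_def box_bump_nonneg)
qed

lemma corr_count_le_card_star_tuples:
  assumes "\<And>r. r \<in> {1..<k} \<Longrightarrow> s r \<le> S"
  shows "corr_count x k s N
    \<le> card (star_tuples (\<lambda>a b. \<bar>signed_dist (x a - x b)\<bar> \<le> S / N) k N) / N"
proof -
  have "{i \<in> distinct_tuples k N. \<forall>r\<in>{1..<k}. nint_dist (x (i 1) - x (i (r + 1))) \<le> s r / real N}
    \<subseteq> star_tuples (\<lambda>a b. \<bar>signed_dist (x a - x b)\<bar> \<le> S / N) k N"
    unfolding star_tuples_def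
    by (smt (verit) Collect_mono_iff abs_signed_dist_le_nint_dist assms divide_right_mono of_nat_0_le_iff)
  then have "card {i \<in> distinct_tuples k N. \<forall>r\<in>{1..<k}. nint_dist (x (i 1) - x (i (r + 1))) \<le> s r / real N}
    \<le> card (star_tuples (\<lambda>a b. \<bar>signed_dist (x a - x b)\<bar> \<le> S / N) k N)"
    by (rule card_mono[OF finite_star_tuples])
  then show ?thesis unfolding corr_count_def by (simp add: divide_right_mono)
qed

lemma card_star_tuples_le_corr_sum:
  "card (star_tuples (\<lambda>a b. \<bar>signed_dist (x a - x b)\<bar> \<le> S / N) p N) / N \<le> corr_sum x p (box_bump p S) N"
proof (cases "N = 0")
  case False
  let ?T = "star_tuples (\<lambda>a b. \<bar>signed_dist (x a - x b)\<bar> \<le> S / N) p N"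
  let ?g = "\<lambda>i. box_bump p S (\<lambda>r\<in>{1..<p}. real N * signed_dist (x (i 1) - x (i (r + 1))))"
  have "real (card ?T) = (\<Sum>i\<in>?T. 1)" by simp
  \<comment> \<open>Scaling by \<open>N\<close> turns the bound \<open>S / N\<close> into
    \<open>S\<close>, so every star tuple is evaluated where the bump is at least 1.\<close>
  also have "\<dots> \<le> (\<Sum>i\<in>?T. ?g i)"
    using False by (intro sum_mono box_bump_ge_1) (simp add: star_tuples_def abs_mult field_simps)
  also have "\<dots> \<le> (\<Sum>i\<in>distinct_tuples p N. ?g i)"
    by (rule sum_mono2[OF finite_distinct_tuples]) (auto simp: star_tuples_def box_bump_nonneg)
  finally show ?thesis unfolding corr_sum_def by (simp add: divide_right_mono)
qed (simp add: corr_sum_def)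

theorem theorem3:
  fixes k :: nat and x :: "nat \<Rightarrow> real" and s :: "nat \<Rightarrow> real"
  assumes "k \<ge> 2"
    and "\<And>n. n \<ge> 1 \<Longrightarrow> x n \<in> {0..1}"
    and "\<And>r. r \<in> {1..<k} \<Longrightarrow> s r > 0"
    and "limsup (\<lambda>N. ereal (corr_count x k s N)) = \<infinity>"
  shows "\<forall>p\<ge>k. \<not> poissonian_correlations p x"
proof (intro allI impI notI)
  fix p assume p: "p \<ge> k" and pc: "poissonian_correlations p x"
  define S where "S = Max (s ` {1..<k})"
  have S: "s r \<le> S" if "r \<in> {1..<k}" for r
    unfolding S_def using that by (intro Max_ge) auto
  define E where "E N = (\<lambda>a b. \<bar>signed_dist (x a - x b)\<bar> \<le> S / real N)" for N
  have "1 \<le> k" using assms(1) by simp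
  from card_star_tuples_le[OF this p] obtain C
    where C: "\<And>E N. card (star_tuples E k N) \<le> card (star_tuples E p N) + N * C" by blast
  \<comment> \<open>Convergence to a finite limit bounds the correlation sums uniformly in
    \<open>N\<close>.\<close>
  have "convergent (\<lambda>N. corr_sum x p (box_bump p S) N)"
    using pc box_bump_in_Cc_nonneg by (auto simp: poissonian_correlations_def convergent_def)
  then obtain B where B: "\<bar>corr_sum x p (box_bump p S) N\<bar> \<le> B" for N
    by (metis convergent_imp_Bseq Bseq_def real_norm_def)
  have "corr_count x k s N \<le> B + C" for N
  proof -
    have "corr_count x k s N \<le> card (star_tuples (E N) k N) / N"
      unfolding E_def using S by (rule corr_count_le_card_star_tuples)
    also have "\<dots> \<le> real (card (star_tuples (E N) p N) + N * C) / N"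
      by (intro divide_right_mono of_nat_mono C) simp
    \<comment> \<open>Equality can fail at \<open>N = 0\<close>, where both quotients are 0 by
      convention.\<close>
    also have "\<dots> \<le> card (star_tuples (E N) p N) / N + C"
      by (cases "N = 0") (simp_all add: add_divide_distrib)
    also have "\<dots> \<le> B + C"
      using card_star_tuples_le_corr_sum[of x S N p] B[of N] unfolding E_def by linarith
    finally show ?thesis .
  qed
  then have "limsup (\<lambda>N. ereal (corr_count x k s N)) \<le> ereal (B + C)"
    by (intro Limsup_bounded) simp
  with assms(4) show False by simp
qed

end
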